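(* Let $A, B, C$ be finite alphabets, and let $\varphi : A^{+} \to C^{+}$, $\psi : B^{+} \to C^{+}$ be two epimorphisms of semigroups. Let $\varphi' : A^{*}\to C^{*}$ and $\psi' : B^{*}\to C^{*}$ be the extensions of $\varphi,\psi$ to monoid homomorphisms mapping $\varepsilon_A$ and $\varepsilon_B$ to $\varepsilon_C$, and let $\mathcal{A}_{\varphi',\psi'}$ be the two-tape automaton associated to $(\varphi',\psi')$ (defined in the context). Then the fiber product $\Pi(\varphi,\psi) = \{(\alpha,\beta)\in A^{+}\times B^{+} : \varphi(\alpha)=\psi(\beta)\}$ is finitely generated (as a semigroup) if and only if $\mathcal{A}_{\varphi',\psi'}$ has no cycles.
   Context: For an alphabet $A$, $A^{*}$ is the free monoid over $A$ with empty word $\varepsilon_A$, and $A^{+} = A^{*}\setminus\{\varepsilon_A\}$ is the free semigroup. "Epimorphism" means surjective homomorphism. For words, $u \leq_p w$ means $u$ is a prefix of $w$; $u <_s w$ means $u$ is a suffix of $w$ with $u \ne w$; if $u \leq_p w$ then $u^{-1}w$ is the unique word $u'$ with $uu' = w$. A two-tape automaton is a tuple $(Q,\Sigma_1,\Sigma_2,\delta,\iota,F)$ with $Q$ a finite set of states, input alphabets $\Sigma_1,\Sigma_2$, transition relation $\delta \subseteq Q\times\Sigma\times Q$ where $\Sigma = (\Sigma_1\cup\{\varepsilon_1\})\times(\Sigma_2\cup\{\varepsilon_2\})$ ($\varepsilon_1,\varepsilon_2$ the empty words over $\Sigma_1,\Sigma_2$), initial state $\iota \in Q$ and set of final states $F\subseteq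 Q$. A cycle is a finite sequence ($k \geq 1$) of transitions $(q_{i-1},\sigma_i,q_i)_{i=1}^{k}$ in $\delta$ with $q_0 = q_k$. For epimorphisms $f : A^{*}\to C^{*}$ and $g : B^{*}\to C^{*}$, the automaton $\mathcal{A}_{f,g} = (Q,\Sigma_1,\Sigma_2,\delta,\iota,F)$ is given by: $\Sigma_1 = A$, $\Sigma_2 = B$; $Q = Q_1\cup Q_2\cup\{\iota\}\cup\{(\varepsilon_C,\varepsilon_C)\}$, where $\iota$ is a separate symbol, $Q_1 = \{(u,\varepsilon_C) : u \in C^{+},\ \exists w \in f(A),\ u <_s w\}$, $Q_2 = \{(\varepsilon_C,v) : v \in C^{+},\ \exists w\in g(B),\ v <_s w\}$; $F = \{(\varepsilon_C,\varepsilon_C)\}$; and $\delta = \bigcup_{i=1}^{8}\Delta_i \subseteq Q\times\Sigma\times Q$, where $\Delta_1 = \{(\iota,(a,\varepsilon_B),(\varepsilon_C,\varepsilon_C)) : a\in A,\ f(a)=\varepsilon_C\}$; $\Delta_2 = \{(\iota,(\varepsilon_A,b),(\varepsilon_C,\varepsilon_C)) : b\in B,\ g(b)=\varepsilon_C\}$; $\Delta_3 = \{(\iota,(a,b),(g(b)^{-1}f(a),\varepsilon_C)) : a\in A, b\in B,\ g(b)\leq_p f(a),\ g(b)\neq\varepsilon_C\}$; $\Delta_4 = \{(\iota,(a,b),(\varepsilon_C,f(a)^{-1}g(b))) : a\in A, b\in B,\ f(a)\leq_p g(b),\ f(a)\neq\varepsilon_C\}$; $\Delta_5 = \{((u,\varepsilon_C),(\varepsilon_A,b),(g(b)^{-1}u,\varepsilon_C))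 : b\in B,\ u\neq\varepsilon_C,\ g(b)\leq_p u\}$; $\Delta_6 = \{((u,\varepsilon_C),(\varepsilon_A,b),(\varepsilon_C,u^{-1}g(b))) : b\in B,\ u\neq\varepsilon_C,\ u\leq_p g(b)\}$; $\Delta_7 = \{((\varepsilon_C,v),(a,\varepsilon_B),(\varepsilon_C,f(a)^{-1}v)) : a\in A,\ v\neq\varepsilon_C,\ f(a)\leq_p v\}$; $\Delta_8 = \{((\varepsilon_C,v),(a,\varepsilon_B),(v^{-1}f(a),\varepsilon_C)) : a\in A,\ v\neq\varepsilon_C,\ v\leq_p f(a)\}$ (in $\Delta_5,\Delta_6$ the pair $(u,\varepsilon_C)$ ranges over $Q_1$; in $\Delta_7,\Delta_8$ the pair $(\varepsilon_C,v)$ ranges over $Q_2$). *)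

theory Defs
  imports Main "HOL-Library.Sublist"
begin

text \<open>Words over an alphabet \<open>A\<close> are the elements of \<^term>\<open>lists A\<close>, i.e. the free monoid; alphabets
  are sets rather than types, so that the empty alphabet is not excluded.\<close>

definition free_semigroup :: "'a set \<Rightarrow> 'a list set" where
  "free_semigroup A = lists A - {[]}"

definition free_semigroup_epi :: "'a set \<Rightarrow> 'c set \<Rightarrow> ('a list \<Rightarrow> 'c list) \<Rightarrow> bool" where
  "free_semigroup_epi A C \<phi> \<longleftrightarrow>
     (\<forall>u\<in>free_semigroup A. \<forall>v\<in>free_semigroup A. \<phi> (u @ v) = \<phi> u @ \<phi> v) \<and>
     \<phi> ` free_semigroup A = free_semigroup C"

definition monoid_extension :: "('a list \<Rightarrow> 'c list) \<Rightarrow> 'a list \<Rightarrow> 'c list" where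
  "monoid_extension \<phi> w = (if w = [] then [] else \<phi> w)"

inductive_set generated_semigroup :: "('s \<Rightarrow> 's \<Rightarrow> 's) \<Rightarrow> 's set \<Rightarrow> 's set"
  for mul :: "'s \<Rightarrow> 's \<Rightarrow> 's" and X :: "'s set" where
  gen: "x \<in> X \<Longrightarrow> x \<in> generated_semigroup mul X"
| mul: "x \<in> generated_semigroup mul X \<Longrightarrow> y \<in> generated_semigroup mul X \<Longrightarrow>
          mul x y \<in> generated_semigroup mul X"

definition finitely_generated_semigroup :: "('s \<Rightarrow> 's \<Rightarrow> 's) \<Rightarrow> 's set \<Rightarrow> bool" where
  "finitely_generated_semigroup mul S \<longleftrightarrow> (\<exists>X. finite X \<and> X \<subseteq> S \<and> generated_semigroup mul X = S)"

definition pair_append :: "'a list \<times> 'b list \<Rightarrow> 'a list \<times> 'b list \<Rightarrow> 'a list \<times> 'b list" where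
  "pair_append p q = (fst p @ fst q, snd p @ snd q)"

definition fiber_product ::
  "'a set \<Rightarrow> 'b set \<Rightarrow> ('a list \<Rightarrow> 'c list) \<Rightarrow> ('b list \<Rightarrow> 'c list) \<Rightarrow> ('a list \<times> 'b list) set" where
  "fiber_product A B \<phi> \<psi> =
     {(\<alpha>, \<beta>). \<alpha> \<in> free_semigroup A \<and> \<beta> \<in> free_semigroup B \<and> \<phi> \<alpha> = \<psi> \<beta>}"

text \<open>A transition label is a pair of words of length at most one.\<close>

record ('q, 'a, 'b) two_tape_automaton =
  states :: "'q set"
  alphabet1 :: "'a set"
  alphabet2 :: "'b set"
  transitions :: "('q \<times> ('a list \<times> 'b list) \<times> 'q) set"
  initial :: 'q
  final_states :: "'q set"

definition labels :: "'a set \<Rightarrow> 'b set \<Rightarrow> ('a list \<times> 'b list) set" where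
  "labels A B = ((\<lambda>a. [a]) ` A \<union> {[]}) \<times> ((\<lambda>b. [b]) ` B \<union> {[]})"

definition is_two_tape_automaton :: "('q, 'a, 'b) two_tape_automaton \<Rightarrow> bool" where
  "is_two_tape_automaton M \<longleftrightarrow>
     finite (states M) \<and> finite (alphabet1 M) \<and> finite (alphabet2 M) \<and>
     transitions M \<subseteq> states M \<times> labels (alphabet1 M) (alphabet2 M) \<times> states M \<and>
     initial M \<in> states M \<and> final_states M \<subseteq> states M"

definition has_cycle :: "('q, 'a, 'b) two_tape_automaton \<Rightarrow> bool" where
  "has_cycle M \<longleftrightarrow>
     (\<exists>k\<ge>1. \<exists>(q :: nat \<Rightarrow> 'q) \<sigma>.
        (\<forall>i\<in>{1..k}. (q (i - 1), \<sigma> i, q i) \<in> transitions M) \<and> q 0 = q k)"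

datatype 'c state = Init | State "'c list" "'c list"

text \<open>\<open>left_quotient u w\<close> is $u^{-1}w$; it is only meaningful when \<open>u\<close> is a prefix of \<open>w\<close>.\<close>

definition left_quotient :: "'c list \<Rightarrow> 'c list \<Rightarrow> 'c list" where
  "left_quotient u w = drop (length u) w"

context
  fixes A :: "'a set" and B :: "'b set" and C :: "'c set"
    and f :: "'a list \<Rightarrow> 'c list" and g :: "'b list \<Rightarrow> 'c list"
begin

definition Q1 :: "'c state set" where
  "Q1 = {State u [] | u. u \<in> free_semigroup C \<and> (\<exists>a\<in>A. strict_suffix u (f [a]))}"

definition Q2 :: "'c state set" where
  "Q2 = {State [] v | v. v \<in> free_semigroup C \<and> (\<exists>b\<in>B. strict_suffix v (g [b]))}"

definition \<Delta>1 :: "('c state \<times> ('a list \<times> 'b list) \<times> 'c state) set" where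
  "\<Delta>1 = {(Init, ([a], []), State [] []) | a. a \<in> A \<and> f [a] = []}"

definition \<Delta>2 :: "('c state \<times> ('a list \<times> 'b list) \<times> 'c state) set" where
  "\<Delta>2 = {(Init, ([], [b]), State [] []) | b. b \<in> B \<and> g [b] = []}"

definition \<Delta>3 :: "('c state \<times> ('a list \<times> 'b list) \<times> 'c state) set" where
  "\<Delta>3 = {(Init, ([a], [b]), State (left_quotient (g [b]) (f [a])) []) | a b.
           a \<in> A \<and> b \<in> B \<and> prefix (g [b]) (f [a]) \<and> g [b] \<noteq> []}"

definition \<Delta>4 :: "('c state \<times> ('a list \<times> 'b list) \<times> 'c state) set" where
  "\<Delta>4 = {(Init, ([a], [b]), State [] (left_quotient (f [a]) (g [b]))) | a b.
           a \<in> A \<and> b \<in> B \<and> prefix (f [a]) (g [b]) \<and> f [a] \<noteq> []}"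

definition \<Delta>5 :: "('c state \<times> ('a list \<times> 'b list) \<times> 'c state) set" where
  "\<Delta>5 = {(State u [], ([], [b]), State (left_quotient (g [b]) u) []) | u b.
           State u [] \<in> Q1 \<and> b \<in> B \<and> u \<noteq> [] \<and> prefix (g [b]) u}"

definition \<Delta>6 :: "('c state \<times> ('a list \<times> 'b list) \<times> 'c state) set" where
  "\<Delta>6 = {(State u [], ([], [b]), State [] (left_quotient u (g [b]))) | u b.
           State u [] \<in> Q1 \<and> b \<in> B \<and> u \<noteq> [] \<and> prefix u (g [b])}"

definition \<Delta>7 :: "('c state \<times> ('a list \<times> 'b list) \<times> 'c state) set" where
  "\<Delta>7 = {(State [] v, ([a], []), State [] (left_quotient (f [a]) v)) | v a.
           State [] v \<in> Q2 \<and> a \<in> A \<and> v \<noteq> [] \<and> prefix (f [a]) v}"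

definition \<Delta>8 :: "('c state \<times> ('a list \<times> 'b list) \<times> 'c state) set" where
  "\<Delta>8 = {(State [] v, ([a], []), State (left_quotient v (f [a])) []) | v a.
           State [] v \<in> Q2 \<and> a \<in> A \<and> v \<noteq> [] \<and> prefix v (f [a])}"

definition fiber_automaton :: "('c state, 'a, 'b) two_tape_automaton" where
  "fiber_automaton =
     \<lparr> states = Q1 \<union> Q2 \<union> {Init} \<union> {State [] []},
       alphabet1 = A,
       alphabet2 = B,
       transitions = \<Delta>1 \<union> \<Delta>2 \<union> \<Delta>3 \<union> \<Delta>4 \<union> \<Delta>5 \<union> \<Delta>6 \<union> \<Delta>7 \<union> \<Delta>8,
       initial = Init,
       final_states = {State [] []} \<rparr>"

text \<open>Every transition listed above ends in one of the declared states, so \<open>transitions\<close> need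
  not be cut down to these.\<close>

lemma is_two_tape_automaton_fiber_automaton:
  assumes fin: "finite A" "finite B"
    and f: "\<And>a. a \<in> A \<Longrightarrow> f [a] \<in> lists C" and g: "\<And>b. b \<in> B \<Longrightarrow> g [b] \<in> lists C"
  shows "is_two_tape_automaton fiber_automaton"
proof -
  let ?Q = "Q1 \<union> Q2 \<union> {Init} \<union> {State [] []}"
  have fin_suffixes: "finite {u. strict_suffix u w}" for w :: "'c list"
    by (rule finite_subset[of _ "set (suffixes w)"]) (auto simp: strict_suffix_def)
  have "Q1 \<subseteq> (\<lambda>u. State u []) ` (\<Union>a\<in>A. {u. strict_suffix u (f [a])})"
    by (auto simp: Q1_def)
  then have "finite Q1"
    using fin fin_suffixes by (meson finite_UN finite_imageI finite_subset)
  moreover have "Q2 \<subseteq> (\<lambda>v. State [] v) ` (\<Union>b\<in>B. {v. strict_suffix v (g [b])})"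
    by (auto simp: Q2_def)
  then have "finite Q2"
    using fin fin_suffixes by (meson finite_UN finite_imageI finite_subset)
  moreover have lq: "left_quotient u w \<in> lists C" if "w \<in> lists C" for u w :: "'c list"
    using that by (auto simp: left_quotient_def dest: in_set_dropD)
  have sfx: "strict_suffix (left_quotient u w) w" if "prefix u w" "u \<noteq> []" for u w :: "'c list"
    using that by (auto simp: left_quotient_def strict_suffix_def suffix_def prefix_def)
  have sfx': "strict_suffix (left_quotient u w) x" if "strict_suffix w x" for u w x :: "'c list"
    using that suffix_drop[of "length u" w] unfolding left_quotient_def
    by (metis suffix_order.le_less_trans)
  have in1: "State u [] \<in> ?Q" if "u \<in> lists C" "a \<in> A" "strict_suffix u (f [a])" for u a
    using that by (cases "u = []") (auto simp: Q1_def free_semigroup_def)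
  have in2: "State [] v \<in> ?Q" if "v \<in> lists C" "b \<in> B" "strict_suffix v (g [b])" for v b
    using that by (cases "v = []") (auto simp: Q2_def free_semigroup_def)
  have Q1D: "u \<in> lists C \<and> (\<exists>a\<in>A. strict_suffix u (f [a]))" if "State u [] \<in> Q1" for u
    using that by (auto simp: Q1_def free_semigroup_def)
  have Q2D: "v \<in> lists C \<and> (\<exists>b\<in>B. strict_suffix v (g [b]))" if "State [] v \<in> Q2" for v
    using that by (auto simp: Q2_def free_semigroup_def)
  let ?T = "?Q \<times> labels A B \<times> ?Q"
  have "\<Delta>1 \<subseteq> ?T" "\<Delta>2 \<subseteq> ?T"
    unfolding \<Delta>1_def \<Delta>2_def labels_def by blast+
  moreover have quot1: "State (left_quotient w (f [a])) [] \<in> ?Q" if "a \<in> A" "prefix w (f [a])" "w \<noteq> []" for a w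
    using in1[OF lq[OF f] _ sfx] that by metis
  then have "\<Delta>3 \<subseteq> ?T"
    unfolding \<Delta>3_def labels_def by blast
  moreover have quot2: "State [] (left_quotient w (g [b])) \<in> ?Q" if "b \<in> B" "prefix w (g [b])" "w \<noteq> []" for b w
    using in2[OF lq[OF g] _ sfx] that by metis
  then have "\<Delta>4 \<subseteq> ?T"
    unfolding \<Delta>4_def labels_def by blast
  moreover have "State (left_quotient w u) [] \<in> ?Q" if "State u [] \<in> Q1" for u w
    using Q1D[OF that] in1[OF lq _ sfx'] by blast
  then have "\<Delta>5 \<subseteq> ?T"
    unfolding \<Delta>5_def labels_def by blast
  moreover have "\<Delta>6 \<subseteq> ?T"
    unfolding \<Delta>6_def labels_def using quot2 by blast
  moreover have "State [] (left_quotient w v) \<in> ?Q" if "State [] v \<in> Q2" for v w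
    using Q2D[OF that] in2[OF lq _ sfx'] by blast
  then have "\<Delta>7 \<subseteq> ?T"
    unfolding \<Delta>7_def labels_def by blast
  moreover have "\<Delta>8 \<subseteq> ?T"
    unfolding \<Delta>8_def labels_def using quot1 by blast
  ultimately show ?thesis
    using fin by (simp add: is_two_tape_automaton_def fiber_automaton_def)
qed

end

end

theory Submission
  imports Defs
begin

text \<open>Read an element \<open>(\<alpha>, \<beta>)\<close> of the fiber product letter by letter: a first letter on both
  tapes, and then always on the tape whose image lags behind. The state of the automaton is the
  surplus of the leading image, and the final state is reached exactly when the two images read so far agree. Hence the accepted pairs are
  those elements of the fiber product of which no proper nonempty prefix pair lies in the fiber
  product: they are irreducible, and by splitting off one after the other they generate everything
  (\<open>generated_by_accepted\<close>). As irreducible elements belong to every generating set, the fiber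
  product is finitely generated if and only if only finitely many pairs are accepted
  (\<open>finitely_generated_iff_finite_accepted\<close>).

  It remains to compare this with the absence of cycles (\<open>finite_accepted_iff_no_cycle\<close>). A finite
  automaton without cycles has finitely many runs. Conversely, a cycle can be pumped, but this
  yields accepted pairs only if the cycle can be entered from the initial state and left towards
  the final one, and a cycle in the definition of \<open>has_cycle\<close> may be anywhere. Here surjectivity
  enters: because values on letters are nonempty, each letter of \<open>C\<close> is the image of a single
  letter on either tape, so the lagging tape can always catch up one letter at a time. In this way
  every nonempty proper suffix of the image of a letter occurs as a surplus
  and every surplus can be removed (\<open>state_on_accepting_run\<close>).\<close>

section \<open>Runs of two-tape automata\<close>

inductive run :: "('q, 'a, 'b) two_tape_automaton \<Rightarrow> 'q \<Rightarrow> 'a list \<Rightarrow> 'b list \<Rightarrow> 'q \<Rightarrow> bool"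
  for M :: "('q, 'a, 'b) two_tape_automaton" where
  refl: "run M q [] [] q"
| step: "(q, (x, y), q') \<in> transitions M \<Longrightarrow> run M q' \<alpha> \<beta> r \<Longrightarrow> run M q (x @ \<alpha>) (y @ \<beta>) r"

lemma run_append:
  assumes "run M p \<alpha> \<beta> q" and "run M q \<gamma> \<delta> r"
  shows "run M p (\<alpha> @ \<gamma>) (\<beta> @ \<delta>) r"
  using assms by (induction) (auto intro: run.step)

lemma run_single: "(q, (x, y), q') \<in> transitions M \<Longrightarrow> run M q x y q'"
  using run.step[OF _ run.refl] by fastforce

definition accepted :: "('q, 'a, 'b) two_tape_automaton \<Rightarrow> ('a list \<times> 'b list) set" where
  "accepted M = {(\<alpha>, \<beta>). \<exists>r\<in>final_states M. run M (initial M) \<alpha> \<beta> r}"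

lemma finite_transitions:
  assumes "is_two_tape_automaton M"
  shows "finite (transitions M)"
proof (rule finite_subset)
  show "transitions M \<subseteq> states M \<times> labels (alphabet1 M) (alphabet2 M) \<times> states M"
    and "finite (states M \<times> labels (alphabet1 M) (alphabet2 M) \<times> states M)"
    using assms by (auto simp: is_two_tape_automaton_def labels_def)
qed

text \<open>Without cycles, the converse of the finite edge relation is well-founded, so the finiteness of
  the set of readable pairs can be propagated from each state's successors to that state.\<close>

lemma finite_accepted_if_acyclic:
  assumes aut: "is_two_tape_automaton M" and acyc: "\<not> has_cycle M"
  shows "finite (accepted M)"
proof -
  define E where "E = {(p, q). \<exists>\<sigma>. (p, \<sigma>, q) \<in> transitions M}"
  have "E = (\<lambda>(p, \<sigma>, q). (p, q)) ` transitions M"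
    by (force simp: E_def)
  then have "finite E"
    using finite_transitions[OF aut] by simp
  moreover have "acyclic E"
  proof (rule acyclicI, intro allI notI)
    fix p assume "(p, p) \<in> E\<^sup>+"
    then obtain n where "n > 0" "(p, p) \<in> E ^^ n"
      by (auto simp: trancl_power)
    then obtain q where q: "q 0 = p" "q n = p" "\<forall>i<n. (q i, q (Suc i)) \<in> E"
      by (auto simp: relpow_fun_conv)
    then have "\<forall>i. \<exists>\<sigma>. i < n \<longrightarrow> (q i, \<sigma>, q (Suc i)) \<in> transitions M"
      by (auto simp: E_def)
    then obtain \<sigma> where \<sigma>: "\<And>i. i < n \<Longrightarrow> (q i, \<sigma> i, q (Suc i)) \<in> transitions M"
      by metis
    have "(q (i - 1), \<sigma> (i - 1), q i) \<in> transitions M" if "i \<in> {1..n}" for i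
      using \<sigma>[of "i - 1"] that by auto
    then have "has_cycle M"
      unfolding has_cycle_def using \<open>n > 0\<close> q(1,2)
      by (intro exI[of _ n] exI[of _ q] exI[of _ "\<lambda>i. \<sigma> (i - 1)"] conjI ballI) simp_all
    with acyc show False ..
  qed
  ultimately have "wf (E\<inverse>)"
    by (rule finite_acyclic_wf_converse)
  then have "finite {(\<alpha>, \<beta>). \<exists>r. run M p \<alpha> \<beta> r}" for p
  proof (induction p rule: wf_induct_rule)
    case (less p)
    let ?R = "\<lambda>q. {(\<alpha>, \<beta>). \<exists>r. run M q \<alpha> \<beta> r}"
    let ?T = "{t \<in> transitions M. fst t = p}"
    let ?ext = "\<lambda>(p, \<sigma>, q). (\<lambda>\<gamma>. pair_append \<sigma> \<gamma>) ` ?R q"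
    have "?R p \<subseteq> {([], [])} \<union> (\<Union>t\<in>?T. ?ext t)"
    proof
      fix z assume "z \<in> ?R p"
      then obtain \<alpha> \<beta> r where z: "z = (\<alpha>, \<beta>)" and "run M p \<alpha> \<beta> r"
        by blast
      from this(2) show "z \<in> {([], [])} \<union> (\<Union>t\<in>?T. ?ext t)"
      proof (cases rule: run.cases)
        case refl
        then show ?thesis using z by simp
      next
        case (step x y q' \<alpha>' \<beta>')
        then have "z \<in> ?ext (p, (x, y), q')"
          using z by (auto simp: pair_append_def image_iff intro!: exI[of _ \<alpha>'] exI[of _ \<beta>'])
        then show ?thesis
          using step(3) by (intro UnI2 UN_I[of "(p, (x, y), q')"]) (simp, assumption)
      qed
    qed
    moreover have "finite (?ext t)" if T: "t \<in> ?T" for t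
    proof -
      obtain \<sigma> q where t: "t = (p, \<sigma>, q)"
        using T by (cases t) auto
      with T have "(p, \<sigma>, q) \<in> transitions M"
        by simp
      then have "(q, p) \<in> E\<inverse>"
        unfolding E_def by blast
      then have "finite (?R q)"
        by (rule less.IH)
      then show ?thesis
        unfolding t by (simp only: prod.case finite_imageI)
    qed
    then have "finite (\<Union>t\<in>?T. ?ext t)"
      using finite_transitions[OF aut] by (intro finite_UN_I) simp_all
    ultimately show ?case
      by (meson finite.emptyI finite_UnI finite_insert finite_subset)
  qed
  then show ?thesis
    by (rule finite_subset[rotated]) (auto simp: accepted_def)
qed

text \<open>The state on the cycle is returned together with a transition into it and one out of it: for a
  particular automaton, these tell which kind of state it is.\<close>

lemma cycle_pumping:
  assumes "has_cycle M"
    and nonempty: "\<And>p x y q. (p, (x, y), q) \<in> transitions M \<Longrightarrow> x \<noteq> [] \<or> y \<noteq> []"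
  obtains p \<sigma> q where "(p, \<sigma>, q) \<in> transitions M" "\<exists>p' \<sigma>'. (p', \<sigma>', p) \<in> transitions M"
    "\<And>n. \<exists>\<alpha> \<beta>. run M p \<alpha> \<beta> p \<and> n \<le> length \<alpha> + length \<beta>"
proof -
  obtain k :: nat and q \<sigma> where k: "k \<ge> 1" and q0k: "q 0 = q k"
    and tr: "\<forall>i\<in>{1..k}. (q (i - 1), \<sigma> i, q i) \<in> transitions M"
    using assms(1) unfolding has_cycle_def by blast
  have "\<exists>\<alpha> \<beta>. run M (q 0) \<alpha> \<beta> (q i) \<and> i \<le> length \<alpha> + length \<beta>" if "i \<le> k" for i
    using that
  proof (induction i)
    case 0
    then show ?case by (auto intro: run.refl)
  next
    case (Suc i)
    then obtain \<alpha> \<beta> where 1: "run M (q 0) \<alpha> \<beta> (q i)" "i \<le> length \<alpha> + length \<beta>"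
      by auto
    obtain x y where 2: "(q i, (x, y), q (Suc i)) \<in> transitions M"
      using tr[rule_format, of "Suc i"] Suc.prems by (cases "\<sigma> (Suc i)") auto
    have "run M (q 0) (\<alpha> @ x) (\<beta> @ y) (q (Suc i))"
      using 1(1) run_single[OF 2] by (rule run_append)
    moreover have "Suc i \<le> length (\<alpha> @ x) + length (\<beta> @ y)"
      using 1(2) nonempty[OF 2] by (cases x; cases y) auto
    ultimately show ?case by blast
  qed
  from this[of k] obtain \<gamma> \<delta> where loop: "run M (q 0) \<gamma> \<delta> (q 0)" "1 \<le> length \<gamma> + length \<delta>"
    using k q0k by (metis le_refl le_trans)
  have "\<exists>\<alpha> \<beta>. run M (q 0) \<alpha> \<beta> (q 0) \<and> n \<le> length \<alpha> + length \<beta>" for n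
  proof (induction n)
    case 0
    then show ?case by (auto intro: run.refl)
  next
    case (Suc n)
    then obtain \<alpha> \<beta> where "run M (q 0) \<alpha> \<beta> (q 0)" "n \<le> length \<alpha> + length \<beta>"
      by blast
    then have "run M (q 0) (\<alpha> @ \<gamma>) (\<beta> @ \<delta>) (q 0)" "Suc n \<le> length (\<alpha> @ \<gamma>) + length (\<beta> @ \<delta>)"
      using run_append loop by (fast, simp)
    then show ?case by blast
  qed
  moreover have "(q 0, \<sigma> 1, q 1) \<in> transitions M" "(q (k - 1), \<sigma> k, q 0) \<in> transitions M"
    using tr[rule_format, of 1] tr[rule_format, of k] k q0k by auto
  ultimately show ?thesis using that by blast
qed

section \<open>Epimorphisms of free semigroups on letters\<close>

locale letter_epimorphism =
  fixes A :: "'a set" and C :: "'c set" and h :: "'a list \<Rightarrow> 'c list"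
  assumes append: "u \<in> lists A \<Longrightarrow> v \<in> lists A \<Longrightarrow> h (u @ v) = h u @ h v"
    and nonerasing: "a \<in> A \<Longrightarrow> h [a] \<noteq> []"
    and letter_image: "a \<in> A \<Longrightarrow> h [a] \<in> lists C"
    and letter_onto: "c \<in> C \<Longrightarrow> \<exists>a\<in>A. h [a] = [c]"
begin

lemma empty: "h [] = []"
  using append[of "[]" "[]"] by simp

lemma cons: "a \<in> A \<Longrightarrow> u \<in> lists A \<Longrightarrow> h (a # u) = h [a] @ h u"
  using append[of "[a]" u] by simp

lemma eq_empty_iff: "u \<in> lists A \<Longrightarrow> h u = [] \<longleftrightarrow> u = []"
  using cons[of "hd u" "tl u"] by (cases u) (auto simp: empty nonerasing)

end

text \<open>An epimorphism onto \<open>C\<^sup>+\<close> does not decrease length, because its values are nonempty on letters;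
  so every letter of \<open>C\<close>, a word of length one, must be the image of a single letter.\<close>

lemma letter_epimorphism_monoid_extension:
  assumes "free_semigroup_epi A C \<phi>"
  shows "letter_epimorphism A C (monoid_extension \<phi>)"
proof
  have hom: "\<phi> (u @ v) = \<phi> u @ \<phi> v" if "u \<in> lists A" "v \<in> lists A" "u \<noteq> []" "v \<noteq> []" for u v
    using assms that by (simp add: free_semigroup_epi_def free_semigroup_def)
  have img: "\<phi> ` free_semigroup A = free_semigroup C"
    using assms by (simp add: free_semigroup_epi_def)
  have val: "\<phi> u \<noteq> []" "\<phi> u \<in> lists C" if "u \<in> lists A" "u \<noteq> []" for u
  proof -
    have "\<phi> u \<in> free_semigroup C"
      using that unfolding img[symmetric] by (intro imageI) (simp add: free_semigroup_def)
    then show "\<phi> u \<noteq> []" "\<phi> u \<in> lists C"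
      by (simp_all add: free_semigroup_def)
  qed
  show "monoid_extension \<phi> (u @ v) = monoid_extension \<phi> u @ monoid_extension \<phi> v"
    if "u \<in> lists A" "v \<in> lists A" for u v
    using hom that by (simp add: monoid_extension_def)
  show "monoid_extension \<phi> [a] \<noteq> []" "monoid_extension \<phi> [a] \<in> lists C" if "a \<in> A" for a
    using val[of "[a]"] that by (auto simp: monoid_extension_def)
  show "\<exists>a\<in>A. monoid_extension \<phi> [a] = [c]" if "c \<in> C" for c
  proof -
    have "[c] \<in> \<phi> ` free_semigroup A"
      using that unfolding img by (simp add: free_semigroup_def)
    then obtain w where "w \<in> free_semigroup A" "\<phi> w = [c]"
      by (metis imageE)
    then have w: "w \<in> lists A" "w \<noteq> []" "\<phi> w = [c]"
      by (simp_all add: free_semigroup_def)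
    then obtain a v where av: "w = a # v"
      by (cases w) auto
    \<comment> \<open>Otherwise \<open>[c]\<close> would be a product of two nonempty words.\<close>
    have "v = []"
    proof (rule ccontr)
      assume "v \<noteq> []"
      then have "\<phi> [a] @ \<phi> v = [c]" "\<phi> [a] \<noteq> []" "\<phi> v \<noteq> []"
        using w av hom[of "[a]" v] val(1)[of "[a]"] val(1)[of v] by auto
      then show False
        by (simp add: append_eq_Cons_conv)
    qed
    then show ?thesis
      using w av by (auto simp: monoid_extension_def)
  qed
qed

section \<open>The transitions as balance equations\<close>

text \<open>Extending two words \<open>s\<close> and \<open>t\<close> to a common word only depends on the surplus of one over the
  other. This is how the balance of two images is carried across a transition.\<close>

lemma surplus_trade:
  assumes "s @ v = t @ u" "u = [] \<or> v = []"
  shows "s @ x = t @ y \<longleftrightarrow> u @ x = v @ y"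
  using assms by auto

lemma surplus_exists:
  assumes "s @ x = t @ y"
  obtains u v where "s @ v = t @ u" "u = [] \<or> v = []" "u @ x = v @ y"
proof -
  from assms obtain w where "s = t @ w \<and> w @ x = y \<or> s @ w = t \<and> x = w @ y"
    by (auto simp: append_eq_append_conv2)
  then show ?thesis
    using that[of "[]" w] that[of w "[]"] by auto
qed

locale epimorphism_pair = f: letter_epimorphism A C f + g: letter_epimorphism B C g
  for A :: "'a set" and B :: "'b set" and C :: "'c set"
    and f :: "'a list \<Rightarrow> 'c list" and g :: "'b list \<Rightarrow> 'c list" +
  assumes finite_A: "finite A" and finite_B: "finite B"
begin

abbreviation M :: "('c state, 'a, 'b) two_tape_automaton" where
  "M \<equiv> fiber_automaton A B C f g"

text \<open>A state \<open>State u v\<close> with \<open>u = []\<close> or \<open>v = []\<close> records that the image of the first tape is ahead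
  by \<open>u\<close>, or that of the second tape by \<open>v\<close>. Written as a balance equation, the two rules for
  quotients in either direction merge into one, and the two tapes are treated alike.\<close>

lemma transition_iff:
  "(p, (x, y), q) \<in> transitions M \<longleftrightarrow>
    (\<exists>u v. q = State u v \<and> (u = [] \<or> v = []) \<and>
      ((\<exists>a\<in>A. \<exists>b\<in>B. p = Init \<and> x = [a] \<and> y = [b] \<and> f [a] @ v = g [b] @ u) \<or>
       (\<exists>w. \<exists>b\<in>B. p = State w [] \<and> p \<in> Q1 A C f \<and> x = [] \<and> y = [b] \<and> w @ v = g [b] @ u) \<or>
       (\<exists>w. \<exists>a\<in>A. p = State [] w \<and> p \<in> Q2 B C g \<and> x = [a] \<and> y = [] \<and> f [a] @ v = w @ u)))"
    (is "?L \<longleftrightarrow> ?R")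
proof
  have Q: "w \<noteq> []" if "State w [] \<in> Q1 A C f \<or> State [] w \<in> Q2 B C g" for w
    using that by (auto simp: Q1_def Q2_def free_semigroup_def)
  have lq [simp]: "left_quotient z (z @ w) = w" for z w :: "'c list"
    by (simp add: left_quotient_def)
  {
    assume ?L
    then consider "(p, (x, y), q) \<in> \<Delta>3 A B f g" | "(p, (x, y), q) \<in> \<Delta>4 A B f g"
      | "(p, (x, y), q) \<in> \<Delta>5 A B C f g" | "(p, (x, y), q) \<in> \<Delta>6 A B C f g"
      | "(p, (x, y), q) \<in> \<Delta>7 A B C f g" | "(p, (x, y), q) \<in> \<Delta>8 A B C f g"
      by (auto simp: fiber_automaton_def \<Delta>1_def \<Delta>2_def f.nonerasing g.nonerasing)
    then show ?R
    proof cases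
      case 1
      then show ?thesis unfolding \<Delta>3_def prefix_def by auto
    next
      case 2
      then show ?thesis unfolding \<Delta>4_def prefix_def by auto
    next
      case 3
      then show ?thesis unfolding \<Delta>5_def prefix_def by auto
    next
      case 4
      then show ?thesis unfolding \<Delta>6_def prefix_def by auto
    next
      case 5
      then show ?thesis unfolding \<Delta>7_def prefix_def by auto
    next
      case 6
      then show ?thesis unfolding \<Delta>8_def prefix_def by auto
    qed
  }
  assume ?R
  then obtain u v where q: "q = State u v" "u = [] \<or> v = []" and
    "(\<exists>a\<in>A. \<exists>b\<in>B. p = Init \<and> x = [a] \<and> y = [b] \<and> f [a] @ v = g [b] @ u) \<or>
       (\<exists>w. \<exists>b\<in>B. p = State w [] \<and> p \<in> Q1 A C f \<and> x = [] \<and> y = [b] \<and> w @ v = g [b] @ u) \<or>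
       (\<exists>w. \<exists>a\<in>A. p = State [] w \<and> p \<in> Q2 B C g \<and> x = [a] \<and> y = [] \<and> f [a] @ v = w @ u)"
    by (elim exE conjE)
  then consider
      (init) a b where "a \<in> A" "b \<in> B" "p = Init" "x = [a]" "y = [b]" "f [a] @ v = g [b] @ u"
    | (fst) w b where "b \<in> B" "p = State w []" "p \<in> Q1 A C f" "x = []" "y = [b]" "w @ v = g [b] @ u"
    | (snd) w a where "a \<in> A" "p = State [] w" "p \<in> Q2 B C g" "x = [a]" "y = []" "f [a] @ v = w @ u"
    by blast
  then show ?L
  proof cases
    case init
    show ?thesis
    proof (cases "v = []")
      case True
      with init(6) q(2) have eq: "f [a] = g [b] @ u"
        by auto
      have "(p, (x, y), q) \<in> \<Delta>3 A B f g"
        using init(1-5) q(1) \<open>v = []\<close> g.nonerasing[OF init(2)] unfolding \<Delta>3_def by (auto simp: eq)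
      then show ?thesis by (simp add: fiber_automaton_def)
    next
      case False
      with init(6) q(2) have eq: "g [b] = f [a] @ v"
        by auto
      have "(p, (x, y), q) \<in> \<Delta>4 A B f g"
        using init(1-5) q \<open>v \<noteq> []\<close> f.nonerasing[OF init(1)] unfolding \<Delta>4_def by (auto simp: eq)
      then show ?thesis by (simp add: fiber_automaton_def)
    qed
  next
    case fst
    show ?thesis
    proof (cases "v = []")
      case True
      with fst(6) q(2) have eq: "w = g [b] @ u"
        by auto
      have "(p, (x, y), q) \<in> \<Delta>5 A B C f g"
        using fst(1-5) q(1) \<open>v = []\<close> Q[of w] unfolding \<Delta>5_def by (auto simp: eq)
      then show ?thesis by (simp add: fiber_automaton_def)
    next
      case False
      with fst(6) q(2) have eq: "g [b] = w @ v"
        by auto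
      have "(p, (x, y), q) \<in> \<Delta>6 A B C f g"
        using fst(1-5) q \<open>v \<noteq> []\<close> Q[of w] unfolding \<Delta>6_def by (auto simp: eq)
      then show ?thesis by (simp add: fiber_automaton_def)
    qed
  next
    case snd
    show ?thesis
    proof (cases "v = []")
      case True
      with snd(6) q(2) have eq: "f [a] = w @ u"
        by auto
      have "(p, (x, y), q) \<in> \<Delta>8 A B C f g"
        using snd(1-5) q(1) \<open>v = []\<close> Q[of w] unfolding \<Delta>8_def by (auto simp: eq)
      then show ?thesis by (simp add: fiber_automaton_def)
    next
      case False
      with snd(6) q(2) have eq: "w = f [a] @ v"
        by auto
      have "(p, (x, y), q) \<in> \<Delta>7 A B C f g"
        using snd(1-5) q \<open>v \<noteq> []\<close> Q[of w] unfolding \<Delta>7_def by (auto simp: eq)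
      then show ?thesis by (simp add: fiber_automaton_def)
    qed
  qed
qed

lemma automaton: "is_two_tape_automaton M"
  using finite_A finite_B f.letter_image g.letter_image
  by (rule is_two_tape_automaton_fiber_automaton)

abbreviation pair_states :: "'c state set" where
  "pair_states \<equiv> Q1 A C f \<union> Q2 B C g \<union> {State [] []}"

lemma target_in_pair_states:
  assumes "(p, \<sigma>, q) \<in> transitions M"
  shows "q \<in> pair_states"
proof -
  have "q \<in> states M"
    using assms automaton unfolding is_two_tape_automaton_def by blast
  moreover have "q \<noteq> Init"
    using assms by (cases \<sigma>) (auto simp: transition_iff)
  ultimately show ?thesis
    by (auto simp: fiber_automaton_def)
qed

lemma pair_statesE:
  assumes "p \<in> pair_states"
  obtains (final) "p = State [] []"
    | (fst) w where "p = State w []" "p \<in> Q1 A C f" "w \<noteq> []"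
    | (snd) w where "p = State [] w" "p \<in> Q2 B C g" "w \<noteq> []"
  using assms by (auto simp: Q1_def Q2_def free_semigroup_def)

lemma no_transition_from_final: "(State [] [], \<sigma>, q) \<notin> transitions M"
  by (cases \<sigma>) (auto simp: transition_iff Q1_def Q2_def free_semigroup_def)

section \<open>The accepted pairs are irreducible and generate the fiber product\<close>

text \<open>Which tape moves is determined by the state, so a pair of prefixes that balances the images has
  to be met by the run itself; but a run ends as soon as the balance is reached, because the
  final state has no outgoing transitions. The balance and its irreducibility are stated together
  so that a single induction on the run serves both.\<close>

lemma run_to_final:
  assumes "run M (State u v) \<alpha> \<beta> (State [] [])"
  shows "\<alpha> \<in> lists A \<and> \<beta> \<in> lists B \<and> u @ f \<alpha> = v @ g \<beta> \<and>
    (\<forall>\<alpha>1 \<alpha>2 \<beta>1 \<beta>2. \<alpha> = \<alpha>1 @ \<alpha>2 \<longrightarrow> \<beta> = \<beta>1 @ \<beta>2 \<longrightarrow> u @ f \<alpha>1 = v @ g \<beta>1 \<longrightarrow> \<alpha>2 = [] \<and> \<beta>2 = [])"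
  using assms
proof (induction "State u v" \<alpha> \<beta> "State [] [] :: 'c state" arbitrary: u v rule: run.induct)
  case refl
  then show ?case by (simp add: f.empty g.empty)
next
  case (step x y q' \<alpha> \<beta>)
  obtain u' v' where q': "q' = State u' v'"
    using step(1) by (auto simp: transition_iff)
  have \<alpha>: "\<alpha> \<in> lists A" and \<beta>: "\<beta> \<in> lists B" and eq: "u' @ f \<alpha> = v' @ g \<beta>"
    and irr: "\<And>\<alpha>1 \<alpha>2 \<beta>1 \<beta>2. \<alpha> = \<alpha>1 @ \<alpha>2 \<Longrightarrow> \<beta> = \<beta>1 @ \<beta>2 \<Longrightarrow> u' @ f \<alpha>1 = v' @ g \<beta>1 \<Longrightarrow> \<alpha>2 = [] \<and> \<beta>2 = []"
    using step(3)[OF q'] by auto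
  from step(1) q' have or: "u' = [] \<or> v' = []"
    by (simp add: transition_iff)
  from step(1) q' consider
      (fst) b where "b \<in> B" "v = []" "u \<noteq> []" "x = []" "y = [b]" "u @ v' = g [b] @ u'"
    | (snd) a where "a \<in> A" "u = []" "v \<noteq> []" "x = [a]" "y = []" "f [a] @ v' = v @ u'"
    by (auto simp: transition_iff Q1_def Q2_def free_semigroup_def)
  then show ?case
  proof cases
    case fst
    have trade: "u @ s = g [b] @ t \<longleftrightarrow> u' @ s = v' @ t" for s t
      using fst(6) or by (rule surplus_trade)
    have "u @ f \<alpha> = g (b # \<beta>)"
      using eq by (simp add: trade g.cons[of b \<beta>] fst \<beta>)
    moreover have "\<alpha>2 = [] \<and> \<beta>2 = []"
      if split: "\<alpha> = \<alpha>1 @ \<alpha>2" "b # \<beta> = \<beta>1 @ \<beta>2" and bal: "u @ f \<alpha>1 = g \<beta>1" for \<alpha>1 \<alpha>2 \<beta>1 \<beta>2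
    proof -
      have "\<beta>1 \<noteq> []"
        using bal fst g.empty by auto
      then obtain \<beta>' where \<beta>': "\<beta>1 = b # \<beta>'" "\<beta> = \<beta>' @ \<beta>2"
        using split by (cases \<beta>1) auto
      then have "u' @ f \<alpha>1 = v' @ g \<beta>'"
        using bal \<beta> by (simp add: trade g.cons[of b \<beta>'] fst)
      then show ?thesis
        using irr split \<beta>' by blast
    qed
    ultimately show ?thesis
      using fst \<alpha> \<beta> by auto
  next
    case snd
    have trade: "f [a] @ s = v @ t \<longleftrightarrow> u' @ s = v' @ t" for s t
      using snd(6) or by (rule surplus_trade)
    have "f (a # \<alpha>) = v @ g \<beta>"
      using eq by (simp add: trade f.cons[of a \<alpha>] snd \<alpha>)
    moreover have "\<alpha>2 = [] \<and> \<beta>2 = []"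
      if split: "a # \<alpha> = \<alpha>1 @ \<alpha>2" "\<beta> = \<beta>1 @ \<beta>2" and bal: "f \<alpha>1 = v @ g \<beta>1" for \<alpha>1 \<alpha>2 \<beta>1 \<beta>2
    proof -
      have "\<alpha>1 \<noteq> []"
        using bal snd f.empty by auto
      then obtain \<alpha>' where \<alpha>': "\<alpha>1 = a # \<alpha>'" "\<alpha> = \<alpha>' @ \<alpha>2"
        using split by (cases \<alpha>1) auto
      then have "u' @ f \<alpha>' = v' @ g \<beta>1"
        using bal \<alpha> by (simp add: trade f.cons[of a \<alpha>'] snd)
      then show ?thesis
        using irr split \<alpha>' by blast
    qed
    ultimately show ?thesis
      using snd \<alpha> \<beta> by auto
  qed
qed

lemma acceptedE:
  assumes "(\<alpha>, \<beta>) \<in> accepted M"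
  obtains a b u v \<alpha>' \<beta>' where "a \<in> A" "b \<in> B" "\<alpha> = a # \<alpha>'" "\<beta> = b # \<beta>'"
    "f [a] @ v = g [b] @ u" "u = [] \<or> v = []" "run M (State u v) \<alpha>' \<beta>' (State [] [])"
proof -
  have "run M Init \<alpha> \<beta> (State [] [])"
    using assms by (auto simp: accepted_def fiber_automaton_def)
  then show ?thesis
    by cases (auto simp: transition_iff Q1_def Q2_def intro: that)
qed

lemma accepted_balanced_irreducible:
  assumes "(\<alpha>, \<beta>) \<in> accepted M"
  shows "(\<alpha>, \<beta>) \<in> fiber_product A B f g"
    and "\<lbrakk>(\<alpha>1, \<beta>1) \<in> fiber_product A B f g; \<alpha> = \<alpha>1 @ \<alpha>2; \<beta> = \<beta>1 @ \<beta>2\<rbrakk> \<Longrightarrow> \<alpha>2 = [] \<and> \<beta>2 = []"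
proof -
  from assms obtain a b u v \<alpha>' \<beta>' where ab: "a \<in> A" "b \<in> B" "\<alpha> = a # \<alpha>'" "\<beta> = b # \<beta>'"
    and uv: "f [a] @ v = g [b] @ u" "u = [] \<or> v = []"
    and run: "run M (State u v) \<alpha>' \<beta>' (State [] [])"
    by (rule acceptedE)
  have trade: "f [a] @ s = g [b] @ t \<longleftrightarrow> u @ s = v @ t" for s t
    using uv by (rule surplus_trade)
  note R = run_to_final[OF run]
  show "(\<alpha>, \<beta>) \<in> fiber_product A B f g"
    using R ab by (auto simp: fiber_product_def free_semigroup_def f.cons[of a \<alpha>'] g.cons[of b \<beta>'] trade)
  show "\<alpha>2 = [] \<and> \<beta>2 = []"
    if fib: "(\<alpha>1, \<beta>1) \<in> fiber_product A B f g" and split: "\<alpha> = \<alpha>1 @ \<alpha>2" "\<beta> = \<beta>1 @ \<beta>2"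
  proof -
    have bal: "f \<alpha>1 = g \<beta>1" "\<alpha>1 \<noteq> []" "\<beta>1 \<noteq> []" "\<alpha>1 \<in> lists A" "\<beta>1 \<in> lists B"
      using fib by (auto simp: fiber_product_def free_semigroup_def)
    then obtain \<alpha>1' \<beta>1' where 1: "\<alpha>1 = a # \<alpha>1'" "\<beta>1 = b # \<beta>1'"
      using split ab by (cases \<alpha>1; cases \<beta>1) auto
    then have "u @ f \<alpha>1' = v @ g \<beta>1'"
      using bal by (simp add: f.cons[of a \<alpha>1'] g.cons[of b \<beta>1'] trade)
    then show ?thesis
      using R split ab 1 by auto
  qed
qed

text \<open>While one image is ahead, balance forces the other tape to be nonempty, so the run cannot get
  stuck before the final state; what is left on the tapes then is \<open>\<alpha>2\<close> and \<open>\<beta>2\<close>.\<close>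

lemma run_to_final_exists:
  assumes "State u v \<in> pair_states" "\<alpha> \<in> lists A" "\<beta> \<in> lists B" "u @ f \<alpha> = v @ g \<beta>"
  shows "\<exists>\<alpha>1 \<alpha>2 \<beta>1 \<beta>2. \<alpha> = \<alpha>1 @ \<alpha>2 \<and> \<beta> = \<beta>1 @ \<beta>2 \<and> run M (State u v) \<alpha>1 \<beta>1 (State [] [])"
  using assms
proof (induction "length \<alpha> + length \<beta>" arbitrary: u v \<alpha> \<beta> rule: less_induct)
  case less
  from less.prems(1) show ?case
  proof (cases rule: pair_statesE)
    case final
    then show ?thesis
      by (intro exI[of _ "[]"] exI[of _ \<alpha>] exI[of _ \<beta>]) (simp add: run.refl)
  next
    case (fst w)
    then obtain b \<beta>' where \<beta>: "\<beta> = b # \<beta>'"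
      using less.prems(4) g.empty by (cases \<beta>) auto
    then have "u @ f \<alpha> = g [b] @ g \<beta>'"
      using less.prems fst by (simp add: g.cons[of b \<beta>'])
    then obtain u' v' where uv: "u @ v' = g [b] @ u'" "u' = [] \<or> v' = []" "u' @ f \<alpha> = v' @ g \<beta>'"
      by (rule surplus_exists)
    have tr: "(State u v, ([], [b]), State u' v') \<in> transitions M"
      using uv fst less.prems(3) \<beta> by (auto simp: transition_iff)
    have "\<exists>\<alpha>1 \<alpha>2 \<beta>1 \<beta>2. \<alpha> = \<alpha>1 @ \<alpha>2 \<and> \<beta>' = \<beta>1 @ \<beta>2 \<and>
        run M (State u' v') \<alpha>1 \<beta>1 (State [] [])"
      using less.prems \<beta> by (intro less.hyps target_in_pair_states[OF tr] uv(3)) auto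
    then obtain \<alpha>1 \<alpha>2 \<beta>1 \<beta>2 where 1: "\<alpha> = \<alpha>1 @ \<alpha>2" "\<beta>' = \<beta>1 @ \<beta>2"
      "run M (State u' v') \<alpha>1 \<beta>1 (State [] [])"
      by (elim exE conjE)
    show ?thesis
      using run.step[OF tr 1(3)] 1 \<beta>
      by (intro exI[of _ "\<alpha>1"] exI[of _ \<alpha>2] exI[of _ "b # \<beta>1"] exI[of _ \<beta>2]) simp
  next
    case (snd w)
    then obtain a \<alpha>' where \<alpha>: "\<alpha> = a # \<alpha>'"
      using less.prems(4) f.empty by (cases \<alpha>) auto
    then have "f [a] @ f \<alpha>' = v @ g \<beta>"
      using less.prems snd by (simp add: f.cons[of a \<alpha>'])
    then obtain u' v' where uv: "f [a] @ v' = v @ u'" "u' = [] \<or> v' = []" "u' @ f \<alpha>' = v' @ g \<beta>"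
      by (rule surplus_exists)
    have tr: "(State u v, ([a], []), State u' v') \<in> transitions M"
      using uv snd less.prems(2) \<alpha> by (auto simp: transition_iff)
    have "\<exists>\<alpha>1 \<alpha>2 \<beta>1 \<beta>2. \<alpha>' = \<alpha>1 @ \<alpha>2 \<and> \<beta> = \<beta>1 @ \<beta>2 \<and>
        run M (State u' v') \<alpha>1 \<beta>1 (State [] [])"
      using less.prems \<alpha> by (intro less.hyps target_in_pair_states[OF tr] uv(3)) auto
    then obtain \<alpha>1 \<alpha>2 \<beta>1 \<beta>2 where 1: "\<alpha>' = \<alpha>1 @ \<alpha>2" "\<beta> = \<beta>1 @ \<beta>2"
      "run M (State u' v') \<alpha>1 \<beta>1 (State [] [])"
      by (elim exE conjE)
    show ?thesis
      using run.step[OF tr 1(3)] 1 \<alpha>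
      by (intro exI[of _ "a # \<alpha>1"] exI[of _ \<alpha>2] exI[of _ "\<beta>1"] exI[of _ \<beta>2]) simp
  qed
qed

lemma accepted_prefix_exists:
  assumes "(\<alpha>, \<beta>) \<in> fiber_product A B f g"
  obtains \<alpha>1 \<alpha>2 \<beta>1 \<beta>2 where "\<alpha> = \<alpha>1 @ \<alpha>2" "\<beta> = \<beta>1 @ \<beta>2" "(\<alpha>1, \<beta>1) \<in> accepted M"
proof -
  obtain a \<alpha>' b \<beta>' where ab: "\<alpha> = a # \<alpha>'" "\<beta> = b # \<beta>'" and mem: "a \<in> A" "b \<in> B"
    "\<alpha>' \<in> lists A" "\<beta>' \<in> lists B" and bal: "f [a] @ f \<alpha>' = g [b] @ g \<beta>'"
    using assms f.cons[of "hd \<alpha>" "tl \<alpha>"] g.cons[of "hd \<beta>" "tl \<beta>"]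
    by (cases \<alpha>; cases \<beta>) (auto simp: fiber_product_def free_semigroup_def)
  from bal obtain u v where uv: "f [a] @ v = g [b] @ u" "u = [] \<or> v = []" "u @ f \<alpha>' = v @ g \<beta>'"
    by (rule surplus_exists)
  have tr: "(Init, ([a], [b]), State u v) \<in> transitions M"
    using uv mem by (simp add: transition_iff)
  note run_to_final_exists[OF target_in_pair_states[OF tr] mem(3,4) uv(3)]
  then obtain \<alpha>1 \<alpha>2 \<beta>1 \<beta>2 where 1: "\<alpha>' = \<alpha>1 @ \<alpha>2" "\<beta>' = \<beta>1 @ \<beta>2"
    "run M (State u v) \<alpha>1 \<beta>1 (State [] [])"
    by (elim exE conjE)
  have "([a] @ \<alpha>1, [b] @ \<beta>1) \<in> accepted M"
    using run.step[OF tr 1(3)] by (simp add: accepted_def fiber_automaton_def)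
  then show ?thesis
    using that[of "[a] @ \<alpha>1" \<alpha>2 "[b] @ \<beta>1" \<beta>2] ab 1 by simp
qed

lemma generated_by_accepted:
  "generated_semigroup pair_append (accepted M) = fiber_product A B f g"
proof (intro equalityI subsetI)
  fix z assume "z \<in> generated_semigroup pair_append (accepted M)"
  then show "z \<in> fiber_product A B f g"
  proof induction
    case (gen z)
    then show ?case using accepted_balanced_irreducible(1) by (cases z) auto
  next
    case (mul y z)
    then show ?case
      by (auto simp: fiber_product_def free_semigroup_def pair_append_def
          f.append[OF in_listsI in_listsI] g.append[OF in_listsI in_listsI])
  qed
next
  fix z assume "z \<in> fiber_product A B f g"
  then show "z \<in> generated_semigroup pair_append (accepted M)"
  proof (induction z rule: measure_induct_rule[where f = "\<lambda>z. length (fst z)"])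
    case (less z)
    obtain \<alpha> \<beta> where z: "z = (\<alpha>, \<beta>)" by (cases z)
    then obtain \<alpha>1 \<alpha>2 \<beta>1 \<beta>2 where 1: "\<alpha> = \<alpha>1 @ \<alpha>2" "\<beta> = \<beta>1 @ \<beta>2" "(\<alpha>1, \<beta>1) \<in> accepted M"
      using less.prems accepted_prefix_exists by blast
    have fib: "\<alpha> \<in> lists A" "\<beta> \<in> lists B" "f \<alpha> = g \<beta>"
      "\<alpha>1 \<in> lists A" "\<beta>1 \<in> lists B" "f \<alpha>1 = g \<beta>1" "\<alpha>1 \<noteq> []"
      using less.prems accepted_balanced_irreducible(1)[OF 1(3)] z
      by (auto simp: fiber_product_def free_semigroup_def)
    then have rest: "\<alpha>2 \<in> lists A" "\<beta>2 \<in> lists B" "f \<alpha>2 = g \<beta>2"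
      using 1 by (auto simp: f.append g.append)
    show ?case
    proof (cases "\<alpha>2 = []")
      case True
      then have "\<beta>2 = []"
        using rest f.empty g.eq_empty_iff[of \<beta>2] by simp
      with True show ?thesis
        using 1 z by (simp add: generated_semigroup.gen)
    next
      case False
      then have "\<beta>2 \<noteq> []"
        using rest g.empty f.eq_empty_iff[of \<alpha>2] by auto
      with False rest have "(\<alpha>2, \<beta>2) \<in> fiber_product A B f g"
        by (simp add: fiber_product_def free_semigroup_def)
      then have "(\<alpha>2, \<beta>2) \<in> generated_semigroup pair_append (accepted M)"
        using less.IH[of "(\<alpha>2, \<beta>2)"] z 1 fib by simp
      then have "pair_append (\<alpha>1, \<beta>1) (\<alpha>2, \<beta>2) \<in> generated_semigroup pair_append (accepted M)"
        using 1(3) by (blast intro: generated_semigroup.intros)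
      then show ?thesis
        using z 1 by (simp add: pair_append_def[of "(\<alpha>1, \<beta>1)" "(\<alpha>2, \<beta>2)"])
    qed
  qed
qed

text \<open>A product of two elements of the fiber product is never accepted, so an accepted pair that is
  generated by \<open>X\<close> must itself lie in \<open>X\<close>; a finite \<open>X\<close> leaves room for finitely many.\<close>

lemma finitely_generated_iff_finite_accepted:
  "finitely_generated_semigroup pair_append (fiber_product A B f g) \<longleftrightarrow> finite (accepted M)"
proof
  assume "finite (accepted M)"
  moreover have "accepted M \<subseteq> fiber_product A B f g"
    using accepted_balanced_irreducible(1) by auto
  ultimately show "finitely_generated_semigroup pair_append (fiber_product A B f g)"
    unfolding finitely_generated_semigroup_def using generated_by_accepted by blast
next
  assume "finitely_generated_semigroup pair_append (fiber_product A B f g)"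
  then obtain X where X: "finite X" "generated_semigroup pair_append X = fiber_product A B f g"
    unfolding finitely_generated_semigroup_def by blast
  have "z \<in> X" if z: "z \<in> accepted M" for z
  proof -
    have "z \<in> generated_semigroup pair_append X"
      using z accepted_balanced_irreducible(1) X(2) by (cases z) auto
    then show ?thesis
    proof cases
      case gen
      then show ?thesis .
    next
      case (mul x y)
      then have "x \<in> fiber_product A B f g" "y \<in> fiber_product A B f g"
        using X(2) by auto
      moreover from this have "fst y = [] \<and> snd y = []"
        using z mul(1)
        by (intro accepted_balanced_irreducible(2)[of "fst z" "snd z" "fst x" "snd x"])
          (simp_all add: pair_append_def)
      ultimately have False
        by (cases y) (simp add: fiber_product_def free_semigroup_def)
      then show ?thesis ..
    qed
  qed
  then have "accepted M \<subseteq> X" ..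
  then show "finite (accepted M)"
    using X(1) by (rule finite_subset)
qed

section \<open>Every state lies on an accepting run\<close>

text \<open>The second tape catches up by reading letters whose images spell \<open>s\<close>.\<close>

lemma run_consuming_surplus:
  assumes "State (s @ u) [] \<in> Q1 A C f \<union> {State [] []}"
  shows "\<exists>\<beta>. run M (State (s @ u) []) [] \<beta> (State u [])"
  using assms
proof (induction s)
  case Nil
  then show ?case using run.refl by fastforce
next
  case (Cons c s)
  then have Q: "State (c # s @ u) [] \<in> Q1 A C f"
    by simp
  then obtain b where b: "b \<in> B" "g [b] = [c]"
    using g.letter_onto[of c] by (auto simp: Q1_def free_semigroup_def)
  have tr: "(State (c # s @ u) [], ([], [b]), State (s @ u) []) \<in> transitions M"
    using Q b by (auto simp: transition_iff)
  then have "State (s @ u) [] \<in> Q1 A C f \<union> {State [] []}"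
    using target_in_pair_states[OF tr] by (auto simp: Q2_def)
  then obtain \<beta> where "run M (State (s @ u) []) [] \<beta> (State u [])"
    using Cons.IH by blast
  then show ?case
    using run.step[OF tr] by fastforce
qed

text \<open>If the image of \<open>a\<close> is \<open>s @ u\<close>, then \<open>State u []\<close> is reached by reading \<open>a\<close> against letters whose
  images spell \<open>s\<close>; the first of them is consumed together with \<open>a\<close>.\<close>

lemma Q1_state_on_accepting_run:
  assumes "State u [] \<in> Q1 A C f"
  shows "\<exists>\<alpha> \<beta>. run M Init \<alpha> \<beta> (State u [])" and "\<exists>\<alpha> \<beta>. run M (State u []) \<alpha> \<beta> (State [] [])"
proof -
  obtain a s where a: "a \<in> A" "f [a] = s @ u" "s \<noteq> []"
    using assms by (auto simp: Q1_def strict_suffix_def suffix_def)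
  then obtain c s' where s: "s = c # s'"
    by (cases s) auto
  then obtain b where b: "b \<in> B" "g [b] = [c]"
    using g.letter_onto[of c] f.letter_image[OF a(1)] a(2) by auto
  have tr: "(Init, ([a], [b]), State (s' @ u) []) \<in> transitions M"
    using a s b by (auto simp: transition_iff)
  then have "State (s' @ u) [] \<in> Q1 A C f \<union> {State [] []}"
    using target_in_pair_states[OF tr] by (auto simp: Q2_def)
  then obtain \<beta> where "run M (State (s' @ u) []) [] \<beta> (State u [])"
    using run_consuming_surplus by blast
  from run.step[OF tr this] show "\<exists>\<alpha> \<beta>. run M Init \<alpha> \<beta> (State u [])"
    by blast
  show "\<exists>\<alpha> \<beta>. run M (State u []) \<alpha> \<beta> (State [] [])"
    using run_consuming_surplus[of u "[]"] assms by auto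
qed

end

text \<open>Exchanging the tapes turns surpluses of one tape into surpluses of the other, which transfers
  the previous lemma from \<open>Q1\<close> to \<open>Q2\<close>.\<close>

fun swap_state :: "'c state \<Rightarrow> 'c state" where
  "swap_state Init = Init"
| "swap_state (State u v) = State v u"

lemma epimorphism_pair_swap: "epimorphism_pair A B C f g \<Longrightarrow> epimorphism_pair B A C g f"
  by (auto simp: epimorphism_pair_def epimorphism_pair_axioms_def)

lemma run_swap:
  assumes pair: "epimorphism_pair A B C f g" and "run (fiber_automaton A B C f g) p \<alpha> \<beta> q"
  shows "run (fiber_automaton B A C g f) (swap_state p) \<beta> \<alpha> (swap_state q)"
  using assms(2)
proof induction
  case (refl q)
  then show ?case by (rule run.refl)
next
  case (step p x y q \<alpha> \<beta> r)
  have Q: "State w [] \<in> Q1 A C f \<longleftrightarrow> State [] w \<in> Q2 A C f"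
    "State w [] \<in> Q1 B C g \<longleftrightarrow> State [] w \<in> Q2 B C g" for w
    by (auto simp: Q1_def Q2_def)
  have "(swap_state p, (y, x), swap_state q) \<in> transitions (fiber_automaton B A C g f)"
    using step(1) unfolding epimorphism_pair.transition_iff[OF pair]
      epimorphism_pair.transition_iff[OF epimorphism_pair_swap[OF pair]]
    by (auto simp: Q)
  then show ?case
    using step.IH by (rule run.step)
qed

context epimorphism_pair
begin

lemma state_on_accepting_run:
  assumes "p \<in> pair_states" "p \<noteq> State [] []"
  shows "(\<exists>\<alpha> \<beta>. run M Init \<alpha> \<beta> p) \<and> (\<exists>\<alpha> \<beta>. run M p \<alpha> \<beta> (State [] []))"
  using assms(1)
proof (cases rule: pair_statesE)
  case final
  with assms(2) show ?thesis by contradiction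
next
  case (fst w)
  then show ?thesis using Q1_state_on_accepting_run by blast
next
  case (snd w)
  have pair': "epimorphism_pair B A C g f"
    using epimorphism_pair_axioms by (rule epimorphism_pair_swap)
  have "State w [] \<in> Q1 B C g"
    using snd by (auto simp: Q1_def Q2_def)
  note runs = epimorphism_pair.Q1_state_on_accepting_run[OF pair' this]
  show ?thesis
    using runs[THEN exE] run_swap[OF pair'] snd(1)
    by (metis swap_state.simps)
qed

lemma finite_accepted_iff_no_cycle: "finite (accepted M) \<longleftrightarrow> \<not> has_cycle M"
proof
  assume "\<not> has_cycle M"
  then show "finite (accepted M)"
    using finite_accepted_if_acyclic automaton by blast
next
  assume fin: "finite (accepted M)"
  show "\<not> has_cycle M"
  proof
    assume "has_cycle M"
    then obtain p \<sigma> q where out: "(p, \<sigma>, q) \<in> transitions M"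
      and into: "\<exists>p' \<sigma>'. (p', \<sigma>', p) \<in> transitions M"
      and pump: "\<And>n. \<exists>\<alpha> \<beta>. run M p \<alpha> \<beta> p \<and> n \<le> length \<alpha> + length \<beta>"
      by (rule cycle_pumping) (auto simp: transition_iff)
    have "p \<in> pair_states" "p \<noteq> State [] []"
      using into target_in_pair_states out no_transition_from_final by blast+
    then obtain \<alpha>1 \<beta>1 \<alpha>3 \<beta>3 where ends: "run M Init \<alpha>1 \<beta>1 p" "run M p \<alpha>3 \<beta>3 (State [] [])"
      using state_on_accepting_run by blast
    let ?len = "\<lambda>z :: 'a list \<times> 'b list. length (fst z) + length (snd z)"
    obtain N where N: "\<And>z. z \<in> accepted M \<Longrightarrow> ?len z \<le> N"
      using finite_imageI[OF fin, of ?len] unfolding finite_nat_set_iff_bounded_le by blast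
    obtain \<alpha>2 \<beta>2 where loop: "run M p \<alpha>2 \<beta>2 p" "Suc N \<le> length \<alpha>2 + length \<beta>2"
      using pump by blast
    have "run M Init (\<alpha>1 @ \<alpha>2 @ \<alpha>3) (\<beta>1 @ \<beta>2 @ \<beta>3) (State [] [])"
      using ends loop(1) by (blast intro: run_append)
    then have "(\<alpha>1 @ \<alpha>2 @ \<alpha>3, \<beta>1 @ \<beta>2 @ \<beta>3) \<in> accepted M"
      by (simp add: accepted_def fiber_automaton_def)
    from N[OF this] loop(2) show False by simp
  qed
qed

end

theorem corollary5p12:
  fixes A :: "'a set" and B :: "'b set" and C :: "'c set"
    and \<phi> :: "'a list \<Rightarrow> 'c list" and \<psi> :: "'b list \<Rightarrow> 'c list"
  assumes "finite A" and "finite B" and "finite C"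
    and "free_semigroup_epi A C \<phi>" and "free_semigroup_epi B C \<psi>"
  shows "finitely_generated_semigroup pair_append (fiber_product A B \<phi> \<psi>) \<longleftrightarrow>
         \<not> has_cycle (fiber_automaton A B C (monoid_extension \<phi>) (monoid_extension \<psi>))"
proof -
  interpret epimorphism_pair A B C "monoid_extension \<phi>" "monoid_extension \<psi>"
    using assms
    by (simp add: epimorphism_pair_def epimorphism_pair_axioms_def letter_epimorphism_monoid_extension)
  have "fiber_product A B \<phi> \<psi> = fiber_product A B (monoid_extension \<phi>) (monoid_extension \<psi>)"
    by (auto simp: fiber_product_def free_semigroup_def monoid_extension_def)
  then show ?thesis
    using finitely_generated_iff_finite_accepted finite_accepted_iff_no_cycle by simp
qed

end
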